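(* Let $\mathcal A$ be a finitely generated associative algebra over $\mathbb C$, let $\delta_1,\delta_2\in\mathcal D_{\mathcal A}$ be noncommutative vector fields, and let $R=\mathrm{tr}_{\mathcal A}(\delta_1\star\delta_2):\mathcal A\otimes\mathcal A\to\mathcal A\otimes\mathcal A$ be given by $$R(a\otimes b)=\delta_2(b)'\delta_1(a)''\otimes\delta_1(a)'\delta_2(b)''.$$ Then $R$ is a biderivation: for all $a,b,c\in\mathcal A$, $$R(ab\otimes c)=(1\otimes a)\,R(b\otimes c)+R(a\otimes c)\,(b\otimes 1),$$ $$R(a\otimes bc)=(b\otimes 1)\,R(a\otimes c)+R(a\otimes b)\,(1\otimes c).$$
   Context: Tensor products are over $\mathbb C$, and products in $\mathcal A\otimes\mathcal A$ are componentwise. A noncommutative vector field on $\mathcal A$ is a linear map $\delta:\mathcal A\to\mathcal A\otimes\mathcal A$, written $\delta(a)=\delta(a)'\otimes\delta(a)''$ (sum suppressed), satisfying $\delta(ab)=(a\otimes 1)\delta(b)+\delta(a)(1\otimes b)$ for all $a,b\in\mathcal A$. $\mathcal D_{\mathcal A}$ is the space of all noncommutative vector fields. The symbol $\mathrm{tr}_{\mathcal A}(\delta_1\star\delta_2)$ (partial trace of the product of $\delta_1,\delta_2$ in the algebra of noncommutative poly-vector fields) denotes the map $R$ given by the formula in the claim. *)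

theory Defs
  imports Complex_Main "HOL-Library.Poly_Mapping"
begin

section \<open>Complex vector spaces and associative unital complex algebras\<close>

class scaleC =
  fixes scaleC :: "complex \<Rightarrow> 'a \<Rightarrow> 'a" (infixr \<open>*\<^sub>C\<close> 75)

class complex_vector = scaleC + ab_group_add +
  assumes scaleC_add_right: "c *\<^sub>C (x + y) = c *\<^sub>C x + c *\<^sub>C y"
    and scaleC_add_left: "(c + d) *\<^sub>C x = c *\<^sub>C x + d *\<^sub>C x"
    and scaleC_scaleC: "c *\<^sub>C (d *\<^sub>C x) = (c * d) *\<^sub>C x"
    and scaleC_one: "1 *\<^sub>C x = x"

interpretation complex_vector: vector_space "scaleC :: complex \<Rightarrow> 'a \<Rightarrow> 'a::complex_vector"
  by unfold_locales (fact scaleC_add_right scaleC_add_left scaleC_scaleC scaleC_one)+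

text \<open>The superclass is not \<^class>\<open>ring_1\<close>, which assumes \<open>0 \<noteq> 1\<close>: the zero algebra
  is allowed.\<close>

class complex_algebra_1 = complex_vector + ring + monoid_mult +
  assumes mult_scaleC_left: "(c *\<^sub>C x) * y = c *\<^sub>C (x * y)"
    and mult_scaleC_right: "x * (c *\<^sub>C y) = c *\<^sub>C (x * y)"

inductive_set generated_algebra :: "'a::complex_algebra_1 set \<Rightarrow> 'a set" for S where
  one: "1 \<in> generated_algebra S"
| gen: "x \<in> S \<Longrightarrow> x \<in> generated_algebra S"
| add: "x \<in> generated_algebra S \<Longrightarrow> y \<in> generated_algebra S \<Longrightarrow> x + y \<in> generated_algebra S"
| scale: "x \<in> generated_algebra S \<Longrightarrow> c *\<^sub>C x \<in> generated_algebra S"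
| mult: "x \<in> generated_algebra S \<Longrightarrow> y \<in> generated_algebra S \<Longrightarrow> x * y \<in> generated_algebra S"

definition finitely_generated_algebra :: "'a::complex_algebra_1 itself \<Rightarrow> bool" where
  "finitely_generated_algebra _ \<longleftrightarrow> (\<exists>S :: 'a set. finite S \<and> generated_algebra S = UNIV)"

abbreviation clinear :: "('a::complex_vector \<Rightarrow> 'b::complex_vector) \<Rightarrow> bool" where
  "clinear \<equiv> Vector_Spaces.linear scaleC scaleC"

definition cbilinear :: "('a::complex_vector \<Rightarrow> 'b::complex_vector \<Rightarrow> 'c::complex_vector) \<Rightarrow> bool" where
  "cbilinear B \<longleftrightarrow> (\<forall>b. clinear (\<lambda>a. B a b)) \<and> (\<forall>a. clinear (\<lambda>b. B a b))"

lemma clinear_iff: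
  "clinear f \<longleftrightarrow> (\<forall>x y. f (x + y) = f x + f y) \<and> (\<forall>c x. f (c *\<^sub>C x) = c *\<^sub>C f x)"
  by (simp add: Vector_Spaces.linear_iff complex_vector.vector_space_axioms)

lemma cbilinear_iff:
  "cbilinear B \<longleftrightarrow>
    (\<forall>x y b. B (x + y) b = B x b + B y b) \<and> (\<forall>c x b. B (c *\<^sub>C x) b = c *\<^sub>C B x b) \<and>
    (\<forall>a x y. B a (x + y) = B a x + B a y) \<and> (\<forall>c a x. B a (c *\<^sub>C x) = c *\<^sub>C B a x)"
  by (auto simp: cbilinear_def clinear_iff)

lemma clinear_zero: "clinear f \<Longrightarrow> f 0 = 0"
  by (metis clinear_iff add_cancel_right_right)

lemma clinear_diff: "clinear f \<Longrightarrow> f (x - y) = f x - f y"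
  by (metis clinear_iff add_diff_cancel_right' diff_add_cancel)

lemma clinear_sum: "clinear f \<Longrightarrow> f (sum g I) = (\<Sum>i\<in>I. f (g i))"
  by (induction I rule: infinite_finite_induct) (simp_all add: clinear_zero clinear_iff)

lemma cbilinear_sum:
  assumes "cbilinear B"
  shows "B (sum f I) (sum g J) = (\<Sum>i\<in>I. \<Sum>j\<in>J. B (f i) (g j))"
proof -
  have 1: "clinear (\<lambda>a. B a b)" and 2: "clinear (B a)" for a b
    using assms by (auto simp: cbilinear_def)
  show ?thesis
    by (subst clinear_sum[OF 1], subst clinear_sum[OF 2]) (rule refl)
qed


section \<open>The tensor product over the complex numbers\<close>

text \<open>The free vector space on \<open>'a \<times> 'b\<close> modulo the span of the bilinearity relations.\<close>

definition free_scale :: "complex \<Rightarrow> ('x \<Rightarrow>\<^sub>0 complex) \<Rightarrow> ('x \<Rightarrow>\<^sub>0 complex)" where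
  "free_scale c p = Poly_Mapping.map ((*) c) p"

lemma lookup_free_scale [simp]:
  "Poly_Mapping.lookup (free_scale c p) k = c * Poly_Mapping.lookup p k"
  by (simp add: free_scale_def Poly_Mapping.map.rep_eq when_def)

interpretation free: vector_space free_scale
  by unfold_locales (auto intro!: poly_mapping_eqI simp: lookup_add algebra_simps)

definition bilinear_relators ::
  "(('a::complex_vector \<times> 'b::complex_vector) \<Rightarrow>\<^sub>0 complex) set" where
  "bilinear_relators =
     (let e = (\<lambda>a b. Poly_Mapping.single (a, b) 1) in
       {e (x + y) b - e x b - e y b | x y b. True} \<union>
       {e a (x + y) - e a x - e a y | a x y. True} \<union>
       {e (c *\<^sub>C a) b - free_scale c (e a b) | c a b. True} \<union>
       {e a (c *\<^sub>C b) - free_scale c (e a b) | c a b. True})"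

definition tensor_rel ::
  "(('a::complex_vector \<times> 'b::complex_vector) \<Rightarrow>\<^sub>0 complex) \<Rightarrow> (('a \<times> 'b) \<Rightarrow>\<^sub>0 complex) \<Rightarrow> bool"
  where "tensor_rel p q \<longleftrightarrow> p - q \<in> free.span bilinear_relators"

quotient_type (overloaded) ('a, 'b) tensor =
  "('a::complex_vector \<times> 'b::complex_vector) \<Rightarrow>\<^sub>0 complex" / tensor_rel
proof (rule equivpI)
  show "reflp tensor_rel"
    by (simp add: reflp_def tensor_rel_def free.span_zero)
  show "symp tensor_rel"
  proof (rule sympI)
    fix p q
    assume "tensor_rel p q"
    then have "- (p - q) \<in> free.span bilinear_relators"
      unfolding tensor_rel_def by (rule free.span_neg)
    then show "tensor_rel q p" by (simp add: tensor_rel_def)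
  qed
  show "transp tensor_rel"
  proof (rule transpI)
    fix p q r
    assume "tensor_rel p q" "tensor_rel q r"
    then have "(p - q) + (q - r) \<in> free.span bilinear_relators"
      unfolding tensor_rel_def by (rule free.span_add)
    then show "tensor_rel p r" by (simp add: tensor_rel_def)
  qed
qed

instantiation tensor :: (complex_vector, complex_vector) complex_vector
begin

lift_definition zero_tensor :: "('a, 'b) tensor" is 0 .

lift_definition plus_tensor :: "('a, 'b) tensor \<Rightarrow> ('a, 'b) tensor \<Rightarrow> ('a, 'b) tensor" is "(+)"
  unfolding tensor_rel_def by (metis free.span_add add_diff_add)

lift_definition uminus_tensor :: "('a, 'b) tensor \<Rightarrow> ('a, 'b) tensor" is uminus
  unfolding tensor_rel_def by (metis free.span_neg minus_diff_minus)

lift_definition minus_tensor :: "('a, 'b) tensor \<Rightarrow> ('a, 'b) tensor \<Rightarrow> ('a, 'b) tensor" is "(-)"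
proof -
  fix p p' q q' :: "('a \<times> 'b) \<Rightarrow>\<^sub>0 complex"
  assume "tensor_rel p p'" "tensor_rel q q'"
  then have "(p - p') - (q - q') \<in> free.span bilinear_relators"
    unfolding tensor_rel_def by (rule free.span_diff)
  then show "tensor_rel (p - q) (p' - q')"
    unfolding tensor_rel_def by (simp add: algebra_simps)
qed

lift_definition scaleC_tensor :: "complex \<Rightarrow> ('a, 'b) tensor \<Rightarrow> ('a, 'b) tensor" is free_scale
  unfolding tensor_rel_def by (metis free.span_scale free.scale_right_diff_distrib)

instance
proof
  fix s t u :: "('a, 'b) tensor" and c d :: complex
  have eq: "tensor_rel p q" if "p = q" for p q :: "('a \<times> 'b) \<Rightarrow>\<^sub>0 complex"
    using that by (simp add: tensor_rel_def free.span_zero)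
  show "s + t + u = s + (t + u)" by transfer (rule eq, simp add: algebra_simps)
  show "s + t = t + s" by transfer (rule eq, simp add: algebra_simps)
  show "0 + s = s" by transfer (rule eq, simp)
  show "- s + s = 0" by transfer (rule eq, simp)
  show "s - t = s + - t" by transfer (rule eq, simp)
  show "c *\<^sub>C (s + t) = c *\<^sub>C s + c *\<^sub>C t"
    by transfer (rule eq, simp add: free.scale_right_distrib)
  show "(c + d) *\<^sub>C s = c *\<^sub>C s + d *\<^sub>C s"
    by transfer (rule eq, simp add: free.scale_left_distrib)
  show "c *\<^sub>C (d *\<^sub>C s) = (c * d) *\<^sub>C s" by transfer (rule eq, simp)
  show "1 *\<^sub>C s = s" by transfer (rule eq, simp)
qed

end

lift_definition tensor :: "'a::complex_vector \<Rightarrow> 'b::complex_vector \<Rightarrow> ('a, 'b) tensor"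
  (infixl \<open>\<otimes>\<close> 70) is "\<lambda>a b. Poly_Mapping.single (a, b) 1" .

lemma abs_tensor_rep: "abs_tensor (rep_tensor t) = t"
  using Quotient3_tensor by (rule Quotient3_abs_rep)

lemma cbilinear_tensor: "cbilinear (\<otimes>)"
proof -
  let ?e = "\<lambda>(a :: 'a) (b :: 'b). Poly_Mapping.single (a, b) (1 :: complex)"
  have rels:
    "?e (x + y) b - ?e x b - ?e y b \<in> bilinear_relators"
    "?e a (u + v) - ?e a u - ?e a v \<in> bilinear_relators"
    "?e (c *\<^sub>C a) b - free_scale c (?e a b) \<in> bilinear_relators"
    "?e a (c *\<^sub>C b) - free_scale c (?e a b) \<in> bilinear_relators"
    for x y a u v b c
    unfolding bilinear_relators_def Let_def
    by (rule UnI1, rule UnI1, rule UnI1, fast) (rule UnI1, rule UnI1, rule UnI2, fast,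
        rule UnI1, rule UnI2, fast, rule UnI2, fast)
  show ?thesis
    unfolding cbilinear_iff
    by (intro conjI allI; transfer; unfold tensor_rel_def diff_diff_eq[symmetric];
        rule free.span_base; rule rels)
qed

lemma tensor_bilin:
  "(x + y) \<otimes> b = x \<otimes> b + y \<otimes> b"
  "(c *\<^sub>C x) \<otimes> b = c *\<^sub>C (x \<otimes> b)"
  "a \<otimes> (u + v) = a \<otimes> u + a \<otimes> v"
  "a \<otimes> (c *\<^sub>C u) = c *\<^sub>C (a \<otimes> u)"
  using cbilinear_tensor unfolding cbilinear_iff by blast+

text \<open>The linear extension of \<open>f\<close> from the basis \<open>'x\<close>.\<close>

definition free_extend :: "('x \<Rightarrow> 'c::complex_vector) \<Rightarrow> ('x \<Rightarrow>\<^sub>0 complex) \<Rightarrow> 'c" where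
  "free_extend f p = (\<Sum>k\<in>Poly_Mapping.keys p. Poly_Mapping.lookup p k *\<^sub>C f k)"

lemma free_extend_superset:
  assumes "finite K" "Poly_Mapping.keys p \<subseteq> K"
  shows "free_extend f p = (\<Sum>k\<in>K. Poly_Mapping.lookup p k *\<^sub>C f k)"
  unfolding free_extend_def
  by (rule sum.mono_neutral_left) (use assms in \<open>auto simp: in_keys_iff\<close>)

lemma free_extend_single: "free_extend f (Poly_Mapping.single k 1) = f k"
  by (simp add: free_extend_def)

lemma linear_free_extend: "Vector_Spaces.linear free_scale scaleC (free_extend f)"
  unfolding Vector_Spaces.linear_iff
proof (intro conjI allI)
  fix p q :: "'a \<Rightarrow>\<^sub>0 complex" and c
  let ?K = "Poly_Mapping.keys p \<union> Poly_Mapping.keys q"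
  have "Poly_Mapping.keys (p + q) \<subseteq> ?K" by (rule Poly_Mapping.keys_add)
  then show "free_extend f (p + q) = free_extend f p + free_extend f q"
    by (simp add: free_extend_superset[of ?K] lookup_add sum.distrib
        complex_vector.scale_left_distrib)
  have "Poly_Mapping.keys (free_scale c p) \<subseteq> Poly_Mapping.keys p"
    by (auto simp: in_keys_iff)
  then show "free_extend f (free_scale c p) = c *\<^sub>C free_extend f p"
    by (simp add: free_extend_superset[of "Poly_Mapping.keys p"] complex_vector.scale_sum_right)
qed (fact free.vector_space_axioms complex_vector.vector_space_axioms)+

text \<open>The linear map that a bilinear map \<open>B\<close> induces on the tensor product. The value does not
  depend on the chosen representative when \<open>B\<close> is bilinear; otherwise it is meaningless.\<close>

definition tensor_lift ::
  "('a::complex_vector \<Rightarrow> 'b::complex_vector \<Rightarrow> 'c::complex_vector) \<Rightarrow> ('a, 'b) tensor \<Rightarrow> 'c" where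
  "tensor_lift B t = free_extend (\<lambda>(a, b). B a b) (rep_tensor t)"

lemma tensor_lift_abs:
  assumes "cbilinear B"
  shows "tensor_lift B (abs_tensor p) = free_extend (\<lambda>(a, b). B a b) p"
proof -
  let ?L = "free_extend (\<lambda>(a, b). B a b)"
  interpret L: Vector_Spaces.linear free_scale scaleC ?L by (rule linear_free_extend)
  have rel: "?L r = 0" if "r \<in> bilinear_relators" for r
    using that assms
    by (auto simp: bilinear_relators_def L.diff L.scale free_extend_single cbilinear_iff)
  have "tensor_rel (rep_tensor (abs_tensor p)) p"
    by (simp add: tensor.abs_eq_iff[symmetric] abs_tensor_rep)
  then have "rep_tensor (abs_tensor p) - p \<in> free.span bilinear_relators"
    by (simp add: tensor_rel_def)
  then have "?L (rep_tensor (abs_tensor p) - p) = 0"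
    by (rule L.eq_0_on_span[rotated]) (rule rel)
  then show ?thesis by (simp add: tensor_lift_def L.diff)
qed

lemma tensor_lift_tensor [simp]: "cbilinear B \<Longrightarrow> tensor_lift B (a \<otimes> b) = B a b"
  unfolding tensor.abs_eq by (simp add: tensor_lift_abs free_extend_single)

lemma clinear_tensor_lift:
  assumes "cbilinear B"
  shows "clinear (tensor_lift B)"
proof -
  interpret L: Vector_Spaces.linear free_scale scaleC "free_extend (\<lambda>(a, b). B a b)"
    by (rule linear_free_extend)
  show ?thesis
    unfolding clinear_iff
  proof (intro conjI allI)
    fix s t :: "('a, 'b) tensor" and c
    obtain p q where [simp]: "s = abs_tensor p" "t = abs_tensor q"
      by (metis abs_tensor_rep)
    show "tensor_lift B (s + t) = tensor_lift B s + tensor_lift B t"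
      by (simp add: plus_tensor.abs_eq tensor_lift_abs assms L.add)
    show "tensor_lift B (c *\<^sub>C s) = c *\<^sub>C tensor_lift B s"
      by (simp add: scaleC_tensor.abs_eq tensor_lift_abs assms L.scale)
  qed
qed

lemma tensor_eq_sum:
  fixes t :: "('a::complex_vector, 'b::complex_vector) tensor"
  obtains I :: "('a \<times> 'b) set" and x y where "finite I" "t = (\<Sum>i\<in>I. x i \<otimes> y i)"
proof -
  obtain p where p: "t = abs_tensor p" by (metis abs_tensor_rep)
  let ?c = "Poly_Mapping.lookup p" and ?e = "\<lambda>k. Poly_Mapping.single k (1 :: complex)"
  have abs_sum: "abs_tensor (\<Sum>k\<in>K. free_scale (?c k) (?e k)) = (\<Sum>k\<in>K. ?c k *\<^sub>C (fst k \<otimes> snd k))"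
    if "finite K" for K
    using that
    by induction
      (simp_all add: zero_tensor.abs_eq plus_tensor.abs_eq[symmetric] tensor.abs_eq scaleC_tensor.abs_eq)
  have "p = (\<Sum>k\<in>Poly_Mapping.keys p. free_scale (?c k) (?e k))"
    by (rule poly_mapping_eqI)
      (auto simp: lookup_sum lookup_single when_def in_keys_iff if_distrib sum.If_cases cong: if_cong)
  then have "t = (\<Sum>k\<in>Poly_Mapping.keys p. ?c k *\<^sub>C (fst k \<otimes> snd k))"
    using abs_sum[of "Poly_Mapping.keys p"] p by simp
  also have "\<dots> = (\<Sum>k\<in>Poly_Mapping.keys p. (?c k *\<^sub>C fst k) \<otimes> snd k)"
    by (simp add: tensor_bilin)
  finally show ?thesis by (intro that[of "Poly_Mapping.keys p"]) auto
qed

lemma tensor_induct [case_names tensor add]: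
  assumes pure: "\<And>a b. P (a \<otimes> b)" and add: "\<And>s t. P s \<Longrightarrow> P t \<Longrightarrow> P (s + t)"
  shows "P t"
proof -
  have zero: "P 0"
    by (metis pure tensor_bilin(2) complex_vector.scale_zero_left)
  obtain I :: "('a \<times> 'b) set" and x y where "finite I" and t: "t = (\<Sum>i\<in>I. x i \<otimes> y i)"
    by (rule tensor_eq_sum)
  from \<open>finite I\<close> show "P t"
    unfolding t by (induction I) (auto intro: zero pure add)
qed


section \<open>The tensor product of algebras\<close>

text \<open>The map \<open>(a \<otimes> b, c \<otimes> d) \<mapsto> F a b c d\<close>, extended bilinearly.\<close>

definition tensor_lift2 where
  "tensor_lift2 F s t = tensor_lift (\<lambda>a b. tensor_lift (\<lambda>c d. F a b c d) t) s"

lemma tensor_lift2: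
  assumes "\<And>a b. cbilinear (F a b)" and "\<And>c d. cbilinear (\<lambda>a b. F a b c d)"
  shows cbilinear_tensor_lift2: "cbilinear (tensor_lift2 F)"
    and tensor_lift2_tensor: "tensor_lift2 F (a \<otimes> b) (c \<otimes> d) = F a b c d"
proof -
  have lin: "clinear (tensor_lift (F a b))" for a b
    by (rule clinear_tensor_lift) fact
  have bil: "cbilinear (\<lambda>a b. tensor_lift (F a b) t)" for t
  proof (induction t rule: tensor_induct)
    case (tensor c d)
    then show ?case using assms by simp
  next
    case (add s t)
    have eq: "tensor_lift (F a b) (s + t) = tensor_lift (F a b) s + tensor_lift (F a b) t" for a b
      using lin by (simp add: clinear_iff)
    show ?case
      using add by (simp add: cbilinear_iff eq complex_vector.scale_right_distrib algebra_simps)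
  qed
  show "tensor_lift2 F (a \<otimes> b) (c \<otimes> d) = F a b c d"
    unfolding tensor_lift2_def using bil assms by simp
  have "clinear (\<lambda>s. tensor_lift2 F s t)" for t
    unfolding tensor_lift2_def by (rule clinear_tensor_lift) (rule bil)
  moreover have "clinear (tensor_lift2 F s)" for s
  proof (induction s rule: tensor_induct)
    case (tensor a b)
    have "tensor_lift2 F (a \<otimes> b) = tensor_lift (F a b)"
      unfolding tensor_lift2_def using bil by (intro ext) simp
    then show ?case using lin by simp
  next
    case (add s t)
    have "tensor_lift2 F (s + t) u = tensor_lift2 F s u + tensor_lift2 F t u" for u
      unfolding tensor_lift2_def using clinear_tensor_lift[OF bil] by (simp add: clinear_iff)
    then show ?case
      using add by (simp add: clinear_iff complex_vector.scale_right_distrib algebra_simps)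
  qed
  ultimately show "cbilinear (tensor_lift2 F)"
    by (simp add: cbilinear_def)
qed

lemmas algebra_bilin = distrib_left distrib_right mult_scaleC_left mult_scaleC_right tensor_bilin

instantiation tensor :: (complex_algebra_1, complex_algebra_1) complex_algebra_1
begin

definition one_tensor :: "('a, 'b) tensor" where
  "1 = 1 \<otimes> 1"

definition times_tensor :: "('a, 'b) tensor \<Rightarrow> ('a, 'b) tensor \<Rightarrow> ('a, 'b) tensor" where
  "times_tensor = tensor_lift2 (\<lambda>a b c d. (a * c) \<otimes> (b * d))"

instance
proof
  have bil: "cbilinear (times :: ('a, 'b) tensor \<Rightarrow> _)"
    unfolding times_tensor_def
    by (rule cbilinear_tensor_lift2) (auto simp: cbilinear_iff algebra_bilin)
  have times: "(a \<otimes> b) * (c \<otimes> d) = (a * c) \<otimes> (b * d)" for a c :: 'a and b d :: 'b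
    unfolding times_tensor_def
    by (rule tensor_lift2_tensor) (auto simp: cbilinear_iff algebra_bilin)
  have l: "(s + t) * u = s * u + t * u" and r: "s * (t + u) = s * t + s * u"
    for s t u :: "('a, 'b) tensor"
    using bil by (auto simp: cbilinear_iff)
  fix s t u :: "('a, 'b) tensor" and c :: complex
  show "(s + t) * u = s * u + t * u" "s * (t + u) = s * t + s * u"
    by (fact l r)+
  show "(c *\<^sub>C s) * t = c *\<^sub>C (s * t)" "s * (c *\<^sub>C t) = c *\<^sub>C (s * t)"
    using bil by (auto simp: cbilinear_iff)
  show "1 * s = s"
    by (induction s rule: tensor_induct) (simp_all add: one_tensor_def times r)
  show "s * 1 = s"
    by (induction s rule: tensor_induct) (simp_all add: one_tensor_def times l)
  have 1: "(a \<otimes> b) * (a' \<otimes> b') * u = (a \<otimes> b) * ((a' \<otimes> b') * u)" for a a' :: 'a and b b' :: 'b and u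
    by (induction u rule: tensor_induct) (simp_all add: times r mult.assoc)
  have 2: "(a \<otimes> b) * t * u = (a \<otimes> b) * (t * u)" for a :: 'a and b :: 'b
    by (induction t rule: tensor_induct) (simp_all add: 1 l r)
  show "s * t * u = s * (t * u)"
    by (induction s rule: tensor_induct) (simp_all add: 2 l)
qed

end

lemma tensor_times_tensor:
  "(a \<otimes> b) * (c \<otimes> d) = (a * c) \<otimes> (b * d)"
  for a c :: "'a::complex_algebra_1" and b d :: "'b::complex_algebra_1"
  unfolding times_tensor_def
  by (rule tensor_lift2_tensor) (auto simp: cbilinear_iff algebra_bilin)


section \<open>Noncommutative vector fields and biderivations\<close>

definition nc_vector_fields :: "('a::complex_algebra_1 \<Rightarrow> ('a, 'a) tensor) set" where
  "nc_vector_fields =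
     {\<delta>. clinear \<delta> \<and> (\<forall>a b. \<delta> (a * b) = (a \<otimes> 1) * \<delta> b + \<delta> a * (1 \<otimes> b))}"

definition biderivation ::
  "(('a::complex_algebra_1, 'a) tensor \<Rightarrow> ('a, 'a) tensor) \<Rightarrow> bool" where
  "biderivation R \<longleftrightarrow> clinear R \<and>
     (\<forall>a b c. R ((a * b) \<otimes> c) = (1 \<otimes> a) * R (b \<otimes> c) + R (a \<otimes> c) * (b \<otimes> 1)) \<and>
     (\<forall>a b c. R (a \<otimes> (b * c)) = (b \<otimes> 1) * R (a \<otimes> c) + R (a \<otimes> b) * (1 \<otimes> c))"

text \<open>The sum suppressed in \<open>R (a \<otimes> b) = \<delta>\<^sub>2(b)' \<delta>\<^sub>1(a)'' \<otimes> \<delta>\<^sub>1(a)' \<delta>\<^sub>2(b)''\<close> is made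
  independent of the decompositions of \<open>\<delta>\<^sub>1 a\<close> and \<open>\<delta>\<^sub>2 b\<close> by extending
  \<open>(x' \<otimes> x'', y' \<otimes> y'') \<mapsto> y' x'' \<otimes> x' y''\<close> bilinearly; the lemma \<open>tr_star_tensor\<close> below is the
  formula for arbitrary decompositions.\<close>

definition tr_star ::
  "('a::complex_algebra_1 \<Rightarrow> ('a, 'a) tensor) \<Rightarrow> ('a \<Rightarrow> ('a, 'a) tensor) \<Rightarrow>
   ('a, 'a) tensor \<Rightarrow> ('a, 'a) tensor" where
  "tr_star \<delta>\<^sub>1 \<delta>\<^sub>2 =
     tensor_lift (\<lambda>a b. tensor_lift2 (\<lambda>x' x'' y' y''. (y' * x'') \<otimes> (x' * y'')) (\<delta>\<^sub>1 a) (\<delta>\<^sub>2 b))"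

lemma tr_star:
  fixes \<delta>\<^sub>1 \<delta>\<^sub>2 :: "'a::complex_algebra_1 \<Rightarrow> ('a, 'a) tensor"
  assumes "clinear \<delta>\<^sub>1" "clinear \<delta>\<^sub>2"
  shows clinear_tr_star: "clinear (tr_star \<delta>\<^sub>1 \<delta>\<^sub>2)"
    and tr_star_tensor:
      "\<delta>\<^sub>1 a = (\<Sum>i\<in>I. x' i \<otimes> x'' i) \<Longrightarrow> \<delta>\<^sub>2 b = (\<Sum>j\<in>J. y' j \<otimes> y'' j) \<Longrightarrow>
       tr_star \<delta>\<^sub>1 \<delta>\<^sub>2 (a \<otimes> b) = (\<Sum>i\<in>I. \<Sum>j\<in>J. (y' j * x'' i) \<otimes> (x' i * y'' j))"
proof -
  let ?F = "\<lambda>(x' :: 'a) (x'' :: 'a) (y' :: 'a) (y'' :: 'a). (y' * x'') \<otimes> (x' * y'')"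
  have F: "cbilinear (?F a b)" "cbilinear (\<lambda>a b. ?F a b c d)" for a b c d
    by (auto simp: cbilinear_iff algebra_bilin)
  note bil = cbilinear_tensor_lift2[of ?F, OF F]
  have bil': "cbilinear (\<lambda>a b. tensor_lift2 ?F (\<delta>\<^sub>1 a) (\<delta>\<^sub>2 b))"
    using bil assms unfolding cbilinear_iff clinear_iff by simp
  then show "clinear (tr_star \<delta>\<^sub>1 \<delta>\<^sub>2)"
    unfolding tr_star_def by (rule clinear_tensor_lift)
  show "tr_star \<delta>\<^sub>1 \<delta>\<^sub>2 (a \<otimes> b) = (\<Sum>i\<in>I. \<Sum>j\<in>J. (y' j * x'' i) \<otimes> (x' i * y'' j))"
    if "\<delta>\<^sub>1 a = (\<Sum>i\<in>I. x' i \<otimes> x'' i)" "\<delta>\<^sub>2 b = (\<Sum>j\<in>J. y' j \<otimes> y'' j)"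
    using that bil' tensor_lift2_tensor[of ?F, OF F]
    by (simp add: tr_star_def cbilinear_sum[OF bil])
qed

end

theory Submission
  imports Defs
begin

text \<open>The value \<open>R (a \<otimes> b)\<close> depends on \<open>a\<close> and \<open>b\<close> only through \<open>\<delta>\<^sub>1 a\<close> and \<open>\<delta>\<^sub>2 b\<close>: it is their image
  under the bilinear crossed product \<open>(x' \<otimes> x'', y' \<otimes> y'') \<mapsto> y' x'' \<otimes> x' y''\<close>. This product moves
  the two outer multiplications of its left argument to the inside: \<open>x'\<close> comes first in the right
  tensor factor and \<open>x''\<close> last in the left one, so multiplying \<open>x'\<close> by \<open>a\<close> from the left
  multiplies the result by \<open>1 \<otimes> a\<close> from the left, and multiplying \<open>x''\<close> by \<open>b\<close> from the right
  multiplies it by \<open>b \<otimes> 1\<close> from the right. The right argument keeps its outer positions, as \<open>y'\<close>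
  comes first on the left and \<open>y''\<close> last on the right. Since the Leibniz rule of a vector field
  uses only these outer multiplications, the Leibniz rules of \<open>\<delta>\<^sub>1\<close> and \<open>\<delta>\<^sub>2\<close> turn into the two
  Leibniz rules of \<open>R\<close>.\<close>

definition crossed_product ::
  "('a::complex_algebra_1, 'a) tensor \<Rightarrow> ('a, 'a) tensor \<Rightarrow> ('a, 'a) tensor" where
  "crossed_product = tensor_lift2 (\<lambda>x' x'' y' y''. (y' * x'') \<otimes> (x' * y''))"

lemma cbilinear_crossed_product: "cbilinear crossed_product"
  unfolding crossed_product_def
  by (rule cbilinear_tensor_lift2) (auto simp: cbilinear_iff algebra_bilin)

lemma crossed_product_tensor:
  "crossed_product (x' \<otimes> x'') (y' \<otimes> y'') = (y' * x'') \<otimes> (x' * y'')"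
  unfolding crossed_product_def
  by (rule tensor_lift2_tensor) (auto simp: cbilinear_iff algebra_bilin)

lemma crossed_product_add:
  "crossed_product (s + t) u = crossed_product s u + crossed_product t u"
  "crossed_product s (t + u) = crossed_product s t + crossed_product s u"
  using cbilinear_crossed_product unfolding cbilinear_iff by blast+

lemma crossed_product_scaleC:
  "crossed_product (c *\<^sub>C s) t = c *\<^sub>C crossed_product s t"
  "crossed_product s (c *\<^sub>C t) = c *\<^sub>C crossed_product s t"
  using cbilinear_crossed_product unfolding cbilinear_iff by blast+

text \<open>Identities between additive functions of two tensors need to be checked only on pure
  tensors, where the four compatibilities below reduce to associativity.\<close>

lemma tensor_induct2:
  assumes pure: "\<And>a b c d. P (a \<otimes> b) (c \<otimes> d)"
    and add_left: "\<And>s s' t. P s t \<Longrightarrow> P s' t \<Longrightarrow> P (s + s') t"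
    and add_right: "\<And>s t t'. P s t \<Longrightarrow> P s t' \<Longrightarrow> P s (t + t')"
  shows "P s t"
proof (induction s rule: tensor_induct)
  case (tensor a b)
  show ?case by (induction t rule: tensor_induct) (auto intro: pure add_right)
qed (rule add_left)

lemma crossed_product_outer_left:
  "crossed_product ((a \<otimes> 1) * s) t = (1 \<otimes> a) * crossed_product s t"
  "crossed_product (s * (1 \<otimes> b)) t = crossed_product s t * (b \<otimes> 1)"
  by (induction s t rule: tensor_induct2)
    (simp_all add: crossed_product_tensor crossed_product_add tensor_times_tensor
      distrib_left distrib_right mult.assoc)

lemma crossed_product_outer_right:
  "crossed_product s ((b \<otimes> 1) * t) = (b \<otimes> 1) * crossed_product s t"
  "crossed_product s (t * (1 \<otimes> c)) = crossed_product s t * (1 \<otimes> c)"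
  by (induction s t rule: tensor_induct2)
    (simp_all add: crossed_product_tensor crossed_product_add tensor_times_tensor
      distrib_left distrib_right mult.assoc)

lemma tr_star_eq_crossed_product:
  assumes "clinear \<delta>\<^sub>1" "clinear \<delta>\<^sub>2"
  shows "tr_star \<delta>\<^sub>1 \<delta>\<^sub>2 (a \<otimes> b) = crossed_product (\<delta>\<^sub>1 a) (\<delta>\<^sub>2 b)"
proof -
  have "cbilinear (\<lambda>a b. crossed_product (\<delta>\<^sub>1 a) (\<delta>\<^sub>2 b))"
    using assms
    by (simp add: cbilinear_iff clinear_iff crossed_product_add crossed_product_scaleC)
  then show ?thesis
    unfolding tr_star_def crossed_product_def[symmetric] by (rule tensor_lift_tensor)
qed

theorem corollary26:
  fixes \<delta>\<^sub>1 \<delta>\<^sub>2 :: "'a::complex_algebra_1 \<Rightarrow> ('a, 'a) tensor"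
  assumes "finitely_generated_algebra TYPE('a)"
    and "\<delta>\<^sub>1 \<in> nc_vector_fields"
    and "\<delta>\<^sub>2 \<in> nc_vector_fields"
  shows "biderivation (tr_star \<delta>\<^sub>1 \<delta>\<^sub>2)"
proof -
  have linear: "clinear \<delta>\<^sub>1" "clinear \<delta>\<^sub>2"
    and leibniz: "\<delta>\<^sub>1 (a * b) = (a \<otimes> 1) * \<delta>\<^sub>1 b + \<delta>\<^sub>1 a * (1 \<otimes> b)"
      "\<delta>\<^sub>2 (a * b) = (a \<otimes> 1) * \<delta>\<^sub>2 b + \<delta>\<^sub>2 a * (1 \<otimes> b)" for a b
    using assms by (auto simp: nc_vector_fields_def)
  show ?thesis
    unfolding biderivation_def
    by (simp add: clinear_tr_star linear tr_star_eq_crossed_product leibniz crossed_product_add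
        crossed_product_outer_left crossed_product_outer_right)
qed

end
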